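(* Let $F\colon\mathcal{A}\to\mathcal{F}$ be a zero-preserving functor between pointed protomodular categories $\mathcal{A}$ and $\mathcal{F}$. Then $F$ is protoadditive if and only if it preserves pullbacks along split epimorphisms.
   Context: A category is pointed if it has a zero object $0$. In a pointed category with pullbacks along split epimorphisms, a split short exact sequence is a triple $(k,f,s)$ of morphisms with $k=\ker(f)$ and $f\circ s=1$. Such a category is protomodular if the split short five lemma holds: for any morphism $(\kappa,\alpha,\beta)$ of split short exact sequences, if $\kappa$ and $\beta$ are isomorphisms then so is $\alpha$. A functor between pointed protomodular categories is protoadditive if it sends every split short exact sequence to a split short exact sequence. Zero-preserving means preserving the zero object. *)

theory Defs
  imports Main
begin

section \<open>Categories and functors\<close>

record ('o, 'm) precategory =
  Obj :: "'o set"
  Arr :: "'m set"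
  Dom :: "'m \<Rightarrow> 'o"
  Cod :: "'m \<Rightarrow> 'o"
  Id :: "'o \<Rightarrow> 'm"
  Comp :: "'m \<Rightarrow> 'm \<Rightarrow> 'm"  (infixr "\<cdot>\<index>" 70)

text \<open>The value of \<open>g \<cdot>\<^bsub>C\<^esub> f\<close> (first \<open>f\<close>, then \<open>g\<close>) is constrained only
  when \<open>Cod C f = Dom C g\<close>.\<close>

definition Hom :: "('o, 'm) precategory \<Rightarrow> 'o \<Rightarrow> 'o \<Rightarrow> 'm set" where
  "Hom C a b = {f \<in> Arr C. Dom C f = a \<and> Cod C f = b}"

locale category =
  fixes C :: "('o, 'm) precategory" (structure)
  assumes Dom_closed: "f \<in> Arr C \<Longrightarrow> Dom C f \<in> Obj C"
    and Cod_closed: "f \<in> Arr C \<Longrightarrow> Cod C f \<in> Obj C"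
    and Id_in_Hom: "a \<in> Obj C \<Longrightarrow> Id C a \<in> Hom C a a"
    and Comp_in_Hom: "\<lbrakk>f \<in> Hom C a b; g \<in> Hom C b c\<rbrakk> \<Longrightarrow> g \<cdot> f \<in> Hom C a c"
    and Comp_Id_left: "f \<in> Hom C a b \<Longrightarrow> Id C b \<cdot> f = f"
    and Comp_Id_right: "f \<in> Hom C a b \<Longrightarrow> f \<cdot> Id C a = f"
    and Comp_assoc: "\<lbrakk>f \<in> Hom C a b; g \<in> Hom C b c; h \<in> Hom C c d\<rbrakk>
      \<Longrightarrow> (h \<cdot> g) \<cdot> f = h \<cdot> (g \<cdot> f)"

record ('o, 'm, 'p, 'n) prefunctor =
  on_obj :: "'o \<Rightarrow> 'p"
  on_arr :: "'m \<Rightarrow> 'n"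

locale category_functor = source: category A + target: category B
  for A :: "('o, 'm) precategory" and B :: "('p, 'n) precategory" +
  fixes F :: "('o, 'm, 'p, 'n) prefunctor"
  assumes on_obj_closed: "a \<in> Obj A \<Longrightarrow> on_obj F a \<in> Obj B"
    and on_arr_in_Hom: "f \<in> Hom A a b \<Longrightarrow> on_arr F f \<in> Hom B (on_obj F a) (on_obj F b)"
    and on_arr_Id: "a \<in> Obj A \<Longrightarrow> on_arr F (Id A a) = Id B (on_obj F a)"
    and on_arr_Comp: "\<lbrakk>f \<in> Hom A a b; g \<in> Hom A b c\<rbrakk>
      \<Longrightarrow> on_arr F (g \<cdot>\<^bsub>A\<^esub> f) = on_arr F g \<cdot>\<^bsub>B\<^esub> on_arr F f"


section \<open>Isomorphisms, zero objects, pullbacks, kernels\<close>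

definition iso_arr :: "('o, 'm) precategory \<Rightarrow> 'm \<Rightarrow> bool" where
  "iso_arr C f \<longleftrightarrow> f \<in> Arr C \<and>
     (\<exists>g \<in> Hom C (Cod C f) (Dom C f).
        g \<cdot>\<^bsub>C\<^esub> f = Id C (Dom C f) \<and> f \<cdot>\<^bsub>C\<^esub> g = Id C (Cod C f))"

definition zero_object :: "('o, 'm) precategory \<Rightarrow> 'o \<Rightarrow> bool" where
  "zero_object C z \<longleftrightarrow> z \<in> Obj C \<and>
     (\<forall>a \<in> Obj C. (\<exists>!f. f \<in> Hom C z a) \<and> (\<exists>!f. f \<in> Hom C a z))"

definition zero_arr :: "('o, 'm) precategory \<Rightarrow> 'm \<Rightarrow> bool" where
  "zero_arr C f \<longleftrightarrow> f \<in> Arr C \<and>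
     (\<exists>z u v. zero_object C z \<and> u \<in> Hom C (Dom C f) z \<and> v \<in> Hom C z (Cod C f)
        \<and> f = v \<cdot>\<^bsub>C\<^esub> u)"

definition section_of :: "('o, 'm) precategory \<Rightarrow> 'm \<Rightarrow> 'm \<Rightarrow> bool" where
  "section_of C s f \<longleftrightarrow> f \<in> Arr C \<and> s \<in> Hom C (Cod C f) (Dom C f)
     \<and> f \<cdot>\<^bsub>C\<^esub> s = Id C (Cod C f)"

definition split_epi :: "('o, 'm) precategory \<Rightarrow> 'm \<Rightarrow> bool" where
  "split_epi C f \<longleftrightarrow> (\<exists>s. section_of C s f)"

text \<open>\<open>pullback C p q f g\<close>: the commutative square \<open>f \<cdot> p = g \<cdot> q\<close> is a pullback of the
  cospan \<open>(f, g)\<close>.\<close>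

definition pullback :: "('o, 'm) precategory \<Rightarrow> 'm \<Rightarrow> 'm \<Rightarrow> 'm \<Rightarrow> 'm \<Rightarrow> bool" where
  "pullback C p q f g \<longleftrightarrow>
     p \<in> Arr C \<and> q \<in> Arr C \<and> f \<in> Arr C \<and> g \<in> Arr C \<and>
     Dom C p = Dom C q \<and> Cod C p = Dom C f \<and> Cod C q = Dom C g \<and> Cod C f = Cod C g \<and>
     f \<cdot>\<^bsub>C\<^esub> p = g \<cdot>\<^bsub>C\<^esub> q \<and>
     (\<forall>x \<in> Obj C. \<forall>u \<in> Hom C x (Dom C f). \<forall>v \<in> Hom C x (Dom C g).
        f \<cdot>\<^bsub>C\<^esub> u = g \<cdot>\<^bsub>C\<^esub> v \<longrightarrow>
        (\<exists>!h. h \<in> Hom C x (Dom C p) \<and> p \<cdot>\<^bsub>C\<^esub> h = u \<and> q \<cdot>\<^bsub>C\<^esub> h = v))"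

definition kernel :: "('o, 'm) precategory \<Rightarrow> 'm \<Rightarrow> 'm \<Rightarrow> bool" where
  "kernel C k f \<longleftrightarrow>
     k \<in> Arr C \<and> f \<in> Arr C \<and> Cod C k = Dom C f \<and> zero_arr C (f \<cdot>\<^bsub>C\<^esub> k) \<and>
     (\<forall>x \<in> Obj C. \<forall>u \<in> Hom C x (Dom C f). zero_arr C (f \<cdot>\<^bsub>C\<^esub> u) \<longrightarrow>
        (\<exists>!h. h \<in> Hom C x (Dom C k) \<and> k \<cdot>\<^bsub>C\<^esub> h = u))"


section \<open>Pointed protomodular categories and protoadditive functors\<close>

definition split_ses :: "('o, 'm) precategory \<Rightarrow> 'm \<Rightarrow> 'm \<Rightarrow> 'm \<Rightarrow> bool" where
  "split_ses C k f s \<longleftrightarrow> kernel C k f \<and> section_of C s f"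

definition split_ses_morphism ::
    "('o, 'm) precategory \<Rightarrow> 'm \<times> 'm \<times> 'm \<Rightarrow> 'm \<times> 'm \<times> 'm \<Rightarrow> 'm \<times> 'm \<times> 'm \<Rightarrow> bool" where
  "split_ses_morphism C = (\<lambda>(k, f, s) (k', f', s') (\<kappa>, \<alpha>, \<beta>).
     split_ses C k f s \<and> split_ses C k' f' s' \<and>
     \<kappa> \<in> Hom C (Dom C k) (Dom C k') \<and>
     \<alpha> \<in> Hom C (Dom C f) (Dom C f') \<and>
     \<beta> \<in> Hom C (Cod C f) (Cod C f') \<and>
     \<alpha> \<cdot>\<^bsub>C\<^esub> k = k' \<cdot>\<^bsub>C\<^esub> \<kappa> \<and>
     \<beta> \<cdot>\<^bsub>C\<^esub> f = f' \<cdot>\<^bsub>C\<^esub> \<alpha> \<and>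
     \<alpha> \<cdot>\<^bsub>C\<^esub> s = s' \<cdot>\<^bsub>C\<^esub> \<beta>)"

locale pointed_protomodular = category +
  assumes pointed: "\<exists>z. zero_object C z"
    and pullbacks_along_split_epis:
      "\<lbrakk>split_epi C f; g \<in> Arr C; Cod C g = Cod C f\<rbrakk> \<Longrightarrow> \<exists>p q. pullback C p q f g"
    and split_short_five:
      "\<lbrakk>split_ses_morphism C (k, f, s) (k', f', s') (\<kappa>, \<alpha>, \<beta>); iso_arr C \<kappa>; iso_arr C \<beta>\<rbrakk>
       \<Longrightarrow> iso_arr C \<alpha>"

definition zero_preserving ::
    "('o, 'm) precategory \<Rightarrow> ('p, 'n) precategory \<Rightarrow> ('o, 'm, 'p, 'n) prefunctor \<Rightarrow> bool" where
  "zero_preserving A B F \<longleftrightarrow> (\<forall>z. zero_object A z \<longrightarrow> zero_object B (on_obj F z))"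

definition protoadditive ::
    "('o, 'm) precategory \<Rightarrow> ('p, 'n) precategory \<Rightarrow> ('o, 'm, 'p, 'n) prefunctor \<Rightarrow> bool" where
  "protoadditive A B F \<longleftrightarrow>
     (\<forall>k f s. split_ses A k f s \<longrightarrow> split_ses B (on_arr F k) (on_arr F f) (on_arr F s))"

definition preserves_pullbacks_along_split_epis ::
    "('o, 'm) precategory \<Rightarrow> ('p, 'n) precategory \<Rightarrow> ('o, 'm, 'p, 'n) prefunctor \<Rightarrow> bool" where
  "preserves_pullbacks_along_split_epis A B F \<longleftrightarrow>
     (\<forall>p q f g. split_epi A f \<and> pullback A p q f g \<longrightarrow>
        pullback B (on_arr F p) (on_arr F q) (on_arr F f) (on_arr F g))"

end

theory Submission
  imports Defs
begin

text \<open>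
  A kernel is a pullback along the arrow from a zero object, so a zero-preserving functor that
  preserves pullbacks along split epimorphisms preserves split short exact sequences. Conversely,
  let \<open>(p, q)\<close> be the pullback of a split epimorphism \<open>f\<close> along \<open>g\<close>. Then \<open>q\<close> is split and a
  kernel \<open>k\<close> of \<open>q\<close> yields the kernel \<open>p \<cdot> k\<close> of \<open>f\<close>. A protoadditive \<open>F\<close> preserves both split
  short exact sequences, hence the comparison arrow from the image of the square to the pullback of
  \<open>F f\<close> along \<open>F g\<close> is the identity on kernels of \<open>F q\<close> and on \<open>F (Cod q)\<close>. The split short five
  lemma makes it an isomorphism.
\<close>

section \<open>Typed arrows and reassociation\<close>

lemma HomI: "f \<in> Arr C \<Longrightarrow> Dom C f = a \<Longrightarrow> Cod C f = b \<Longrightarrow> f \<in> Hom C a b"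
  by (simp add: Hom_def)

lemma HomD:
  assumes "f \<in> Hom C a b"
  shows "f \<in> Arr C" "Dom C f = a" "Cod C f = b"
  using assms by (simp_all add: Hom_def)

context category
begin

lemma Hom_objs:
  assumes "f \<in> Hom C a b"
  shows "a \<in> Obj C" "b \<in> Obj C"
  using assms Dom_closed Cod_closed by (auto simp: Hom_def)

text \<open>Replaces a known composite at the head of a right-nested chain; this is how inverses,
  sections and mediating arrows are absorbed below.\<close>

lemma comp_reassoc:
  assumes "g \<cdot> f = k" "f \<in> Hom C a b" "g \<in> Hom C b c" "h \<in> Hom C x a"
  shows "g \<cdot> (f \<cdot> h) = k \<cdot> h"
  using assms Comp_assoc by metis

section \<open>Pullback squares\<close>

lemma pullbackI:
  assumes "p \<in> Hom C d a" "q \<in> Hom C d b" "f \<in> Hom C a c" "g \<in> Hom C b c" "f \<cdot> p = g \<cdot> q"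
    and "\<And>x u v. \<lbrakk>u \<in> Hom C x a; v \<in> Hom C x b; f \<cdot> u = g \<cdot> v\<rbrakk>
      \<Longrightarrow> \<exists>!h. h \<in> Hom C x d \<and> p \<cdot> h = u \<and> q \<cdot> h = v"
  shows "pullback C p q f g"
  using assms by (simp add: pullback_def HomD)

lemma pullbackE:
  assumes "pullback C p q f g"
  obtains a b c d where "p \<in> Hom C d a" "q \<in> Hom C d b" "f \<in> Hom C a c" "g \<in> Hom C b c"
    "f \<cdot> p = g \<cdot> q"
  using assms that[OF HomI HomI HomI HomI] by (auto simp: pullback_def)

lemma pullback_lift:
  assumes "pullback C p q f g" "p \<in> Hom C d a" "q \<in> Hom C d b"
    and "u \<in> Hom C x a" "v \<in> Hom C x b" "f \<cdot> u = g \<cdot> v"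
  obtains h where "h \<in> Hom C x d" "p \<cdot> h = u" "q \<cdot> h = v"
proof -
  have "\<exists>!h. h \<in> Hom C x d \<and> p \<cdot> h = u \<and> q \<cdot> h = v"
    using assms Hom_objs[OF assms(4)] by (auto simp: pullback_def HomD)
  then show thesis using that by blast
qed

text \<open>Both arrows mediate the same cone \<open>(p \<cdot> h, q \<cdot> h)\<close>, so
  uniqueness of the mediating arrow identifies them.\<close>

lemma pullback_jointly_monic:
  assumes "pullback C p q f g" "p \<in> Hom C d a" "q \<in> Hom C d b"
    and h: "h \<in> Hom C x d" "h' \<in> Hom C x d" and eq: "p \<cdot> h = p \<cdot> h'" "q \<cdot> h = q \<cdot> h'"
  shows "h = h'"
proof -
  obtain c where f: "f \<in> Hom C a c" and g: "g \<in> Hom C b c" and sq: "f \<cdot> p = g \<cdot> q"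
    using pullbackE[OF assms(1)] assms(2,3) HomD(2,3) by metis
  have "f \<cdot> (p \<cdot> h) = g \<cdot> (q \<cdot> h)"
    using sq Comp_assoc[OF h(1) assms(2) f] Comp_assoc[OF h(1) assms(3) g] by simp
  moreover have "p \<cdot> h \<in> Hom C x a" "q \<cdot> h \<in> Hom C x b"
    using assms Comp_in_Hom by blast+
  ultimately have "\<exists>!e. e \<in> Hom C x d \<and> p \<cdot> e = p \<cdot> h \<and> q \<cdot> e = q \<cdot> h"
    using assms(1-3) Hom_objs[OF h(1)] by (auto simp: pullback_def HomD)
  then show ?thesis using h eq by metis
qed

text \<open>If \<open>j\<close> inverts \<open>i\<close>, composing with \<open>j\<close> turns
  mediating arrows into \<open>d\<close> into mediating arrows into \<open>e\<close>. This carries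
  the universal property from a chosen pullback to any square whose comparison arrow is
  invertible.\<close>

lemma pullback_comp_iso:
  assumes pb: "pullback C p q f g" and p: "p \<in> Hom C d a" and q: "q \<in> Hom C d b"
    and i: "i \<in> Hom C e d" and iso: "iso_arr C i"
  shows "pullback C (p \<cdot> i) (q \<cdot> i) f g"
proof -
  obtain c where f: "f \<in> Hom C a c" and g: "g \<in> Hom C b c" and sq: "f \<cdot> p = g \<cdot> q"
    using pullbackE[OF pb] p q HomD(2,3) by metis
  obtain j where j: "j \<in> Hom C d e" and ji: "j \<cdot> i = Id C e" and ij: "i \<cdot> j = Id C d"
    using iso i by (auto simp: iso_arr_def HomD)
  show ?thesis
  proof (rule pullbackI[OF Comp_in_Hom[OF i p] Comp_in_Hom[OF i q] f g])
    show "f \<cdot> (p \<cdot> i) = g \<cdot> (q \<cdot> i)"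
      using sq Comp_assoc[OF i p f] Comp_assoc[OF i q g] by simp
  next
    fix x u v
    assume u: "u \<in> Hom C x a" and v: "v \<in> Hom C x b" and uv: "f \<cdot> u = g \<cdot> v"
    obtain h where h: "h \<in> Hom C x d" "p \<cdot> h = u" "q \<cdot> h = v"
      using pullback_lift[OF pb p q u v uv] .
    show "\<exists>!h. h \<in> Hom C x e \<and> (p \<cdot> i) \<cdot> h = u \<and> (q \<cdot> i) \<cdot> h = v"
    proof (rule ex1I)
      have jh: "j \<cdot> h \<in> Hom C x e" using Comp_in_Hom[OF h(1) j] .
      have "i \<cdot> (j \<cdot> h) = h"
        using comp_reassoc[OF ij j i h(1)] Comp_Id_left[OF h(1)] by simp
      then show "j \<cdot> h \<in> Hom C x e \<and> (p \<cdot> i) \<cdot> (j \<cdot> h) = u \<and> (q \<cdot> i) \<cdot> (j \<cdot> h) = v"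
        using h jh Comp_assoc[OF jh i p] Comp_assoc[OF jh i q] by simp
    next
      fix h' assume h': "h' \<in> Hom C x e \<and> (p \<cdot> i) \<cdot> h' = u \<and> (q \<cdot> i) \<cdot> h' = v"
      then have h'_Hom: "h' \<in> Hom C x e" by simp
      have "i \<cdot> h' = h"
        using h h' Comp_assoc[OF h'_Hom i p] Comp_assoc[OF h'_Hom i q]
        by (intro pullback_jointly_monic[OF pb p q Comp_in_Hom[OF h'_Hom i]]) simp_all
      then show "h' = j \<cdot> h"
        using comp_reassoc[OF ji i j h'_Hom] Comp_Id_left[OF h'_Hom] by simp
    qed
  qed
qed

text \<open>The pair \<open>(s \<cdot> g, Id C b)\<close> is a cone because
  \<open>f \<cdot> s\<close> is an identity; \<open>t\<close> is its mediating arrow.\<close>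

lemma pullback_section:
  assumes pb: "pullback C p q f g" and q: "q \<in> Hom C d b" and p: "p \<in> Hom C d a"
    and s: "section_of C s f"
  obtains t where "t \<in> Hom C b d" "p \<cdot> t = s \<cdot> g" "section_of C t q"
proof -
  obtain c where f: "f \<in> Hom C a c" and g: "g \<in> Hom C b c"
    using pullbackE[OF pb] p q HomD(2,3) by metis
  have s': "s \<in> Hom C c a" "f \<cdot> s = Id C c"
    using s f by (auto simp: section_of_def HomD)
  have b: "b \<in> Obj C" using Hom_objs[OF q] by blast
  have "f \<cdot> (s \<cdot> g) = g \<cdot> Id C b"
    using comp_reassoc[OF s'(2,1) f g] Comp_Id_left[OF g] Comp_Id_right[OF g] by simp
  then obtain t where "t \<in> Hom C b d" "p \<cdot> t = s \<cdot> g" "q \<cdot> t = Id C b"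
    using pullback_lift[OF pb p q Comp_in_Hom[OF g s'(1)] Id_in_Hom[OF b]] by blast
  then show thesis using that q by (auto simp: section_of_def HomD)
qed

section \<open>Zero arrows\<close>

lemma zero_arr_iff:
  assumes z: "zero_object C z" and u: "u \<in> Hom C a z" and v: "v \<in> Hom C z b"
    and f: "f \<in> Hom C a b"
  shows "zero_arr C f \<longleftrightarrow> f = v \<cdot> u"
proof
  assume "f = v \<cdot> u"
  then show "zero_arr C f" using assms by (auto simp: zero_arr_def HomD)
next
  assume "zero_arr C f"
  then obtain z' u' v' where z': "zero_object C z'" and u': "u' \<in> Hom C a z'"
    and v': "v' \<in> Hom C z' b" and f': "f = v' \<cdot> u'"
    using f by (auto simp: zero_arr_def HomD)
  \<comment> \<open>The comparison arrow between the two zero objects: initiality of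
    \<open>z\<close> and terminality of \<open>z'\<close> show that both factorizations give the
    same composite.\<close>
  obtain w where w: "w \<in> Hom C z z'"
    using z Hom_objs[OF u'] by (auto simp: zero_object_def)
  have "w \<cdot> u = u'"
    using z' Hom_objs[OF u] Comp_in_Hom[OF u w] u' by (auto simp: zero_object_def)
  moreover have "v' \<cdot> w = v"
    using z Hom_objs[OF v] Comp_in_Hom[OF w v'] v by (auto simp: zero_object_def)
  ultimately show "f = v \<cdot> u"
    using f' comp_reassoc[OF _ w v' u] by simp
qed

lemma zero_arr_Hom:
  assumes "zero_arr C f" "f \<in> Hom C a b"
  obtains z u v where "zero_object C z" "u \<in> Hom C a z" "v \<in> Hom C z b" "f = v \<cdot> u"
  using assms by (auto simp: zero_arr_def HomD)

lemma zero_arr_eq: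
  assumes "zero_arr C f" "zero_arr C g" "f \<in> Hom C a b" "g \<in> Hom C a b"
  shows "f = g"
  using zero_arr_Hom[OF assms(1,3)] zero_arr_iff[OF _ _ _ assms(4)] assms(2) by metis

lemma zero_arr_comp_left:
  assumes "zero_arr C f" and f: "f \<in> Hom C a b" and g: "g \<in> Hom C b c"
  shows "zero_arr C (g \<cdot> f)"
proof -
  obtain z u v where z: "zero_object C z" and u: "u \<in> Hom C a z" and v: "v \<in> Hom C z b"
    and fe: "f = v \<cdot> u"
    using zero_arr_Hom[OF assms(1,2)] .
  have "g \<cdot> f = (g \<cdot> v) \<cdot> u" using fe Comp_assoc[OF u v g] by simp
  then show ?thesis
    using zero_arr_iff[OF z u Comp_in_Hom[OF v g] Comp_in_Hom[OF f g]] by simp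
qed

lemma zero_arr_comp_right:
  assumes "zero_arr C g" and f: "f \<in> Hom C a b" and g: "g \<in> Hom C b c"
  shows "zero_arr C (g \<cdot> f)"
proof -
  obtain z u v where z: "zero_object C z" and u: "u \<in> Hom C b z" and v: "v \<in> Hom C z c"
    and ge: "g = v \<cdot> u"
    using zero_arr_Hom[OF assms(1) g] .
  have "g \<cdot> f = v \<cdot> (u \<cdot> f)" using ge Comp_assoc[OF f u v] by simp
  then show ?thesis
    using zero_arr_iff[OF z Comp_in_Hom[OF f u] v Comp_in_Hom[OF f g]] by simp
qed

section \<open>Kernels and their behaviour under pullback\<close>

lemma kernelI:
  assumes "k \<in> Hom C a b" "f \<in> Hom C b c" "zero_arr C (f \<cdot> k)"
    and "\<And>x u. \<lbrakk>u \<in> Hom C x b; zero_arr C (f \<cdot> u)\<rbrakk> \<Longrightarrow> \<exists>!h. h \<in> Hom C x a \<and> k \<cdot> h = u"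
  shows "kernel C k f"
  using assms by (simp add: kernel_def HomD)

lemma kernelD:
  assumes "kernel C k f"
  shows "k \<in> Arr C" "f \<in> Arr C" "Cod C k = Dom C f" "zero_arr C (f \<cdot> k)"
  using assms by (simp_all add: kernel_def)

lemma kernel_ex1:
  assumes "kernel C k f" "k \<in> Hom C a b" "u \<in> Hom C x b" "zero_arr C (f \<cdot> u)"
  shows "\<exists>!h. h \<in> Hom C x a \<and> k \<cdot> h = u"
  using assms Hom_objs[OF assms(3)] by (auto simp: kernel_def HomD)

text \<open>Since \<open>z\<close> is terminal, the leg \<open>u\<close> imposes no condition on
  mediating arrows, and commutativity of a square over \<open>v\<close> says exactly that the
  composite with \<open>f\<close> is zero.\<close>

lemma kernel_iff_pullback:
  assumes z: "zero_object C z" and k: "k \<in> Hom C a b" and f: "f \<in> Hom C b c"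
    and u: "u \<in> Hom C a z" and v: "v \<in> Hom C z c"
  shows "kernel C k f \<longleftrightarrow> pullback C k u f v"
proof
  assume ker: "kernel C k f"
  show "pullback C k u f v"
  proof (rule pullbackI[OF k u f v])
    show "f \<cdot> k = v \<cdot> u"
      using zero_arr_iff[OF z u v Comp_in_Hom[OF k f]] kernelD[OF ker] by simp
  next
    fix x w w'
    assume w: "w \<in> Hom C x b" and w': "w' \<in> Hom C x z" and eq: "f \<cdot> w = v \<cdot> w'"
    have "zero_arr C (f \<cdot> w)"
      using zero_arr_iff[OF z w' v Comp_in_Hom[OF w f]] eq by simp
    moreover have "u \<cdot> h = w'" if "h \<in> Hom C x a" for h
      using z Hom_objs[OF w'] w' Comp_in_Hom[OF that u] by (auto simp: zero_object_def)
    ultimately show "\<exists>!h. h \<in> Hom C x a \<and> k \<cdot> h = w \<and> u \<cdot> h = w'"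
      using kernel_ex1[OF ker k w] by blast
  qed
next
  assume pb: "pullback C k u f v"
  show "kernel C k f"
  proof (rule kernelI[OF k f])
    have "f \<cdot> k = v \<cdot> u" using pb by (simp add: pullback_def)
    then show "zero_arr C (f \<cdot> k)"
      using zero_arr_iff[OF z u v Comp_in_Hom[OF k f]] by simp
  next
    fix x w assume w: "w \<in> Hom C x b" and zero: "zero_arr C (f \<cdot> w)"
    obtain w' where w': "w' \<in> Hom C x z"
      using z Hom_objs[OF w] by (auto simp: zero_object_def)
    have "f \<cdot> w = v \<cdot> w'" using zero_arr_iff[OF z w' v Comp_in_Hom[OF w f]] zero by simp
    then obtain h where h: "h \<in> Hom C x a" "k \<cdot> h = w"
      using pullback_lift[OF pb k u w w'] by blast
    moreover have "u \<cdot> h = u \<cdot> h'" if "h' \<in> Hom C x a" for h'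
      using z Hom_objs[OF w] Comp_in_Hom[OF h(1) u] Comp_in_Hom[OF that u]
      by (auto simp: zero_object_def)
    then have "h' = h" if "h' \<in> Hom C x a" "k \<cdot> h' = w" for h'
      using that h pullback_jointly_monic[OF pb k u that(1) h(1)] by simp
    ultimately show "\<exists>!h. h \<in> Hom C x a \<and> k \<cdot> h = w" by blast
  qed
qed

text \<open>Composition with \<open>p\<close> is a bijection from the arrows annihilated by
  \<open>q\<close> to those annihilated by \<open>f\<close>, so universality transfers between
  \<open>k\<close> and \<open>p \<cdot> k\<close>. The backward direction produces the kernel of
  \<open>f\<close> in the source category, the forward one recognizes a kernel of the comparison
  pullback's leg.\<close>

lemma kernel_pullback_iff:
  assumes pb: "pullback C p q f g" and p: "p \<in> Hom C d a" and q: "q \<in> Hom C d b"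
    and k: "k \<in> Hom C e d" and qk: "zero_arr C (q \<cdot> k)"
  shows "kernel C (p \<cdot> k) f \<longleftrightarrow> kernel C k q"
proof -
  obtain c where f: "f \<in> Hom C a c" and g: "g \<in> Hom C b c" and sq: "f \<cdot> p = g \<cdot> q"
    using pullbackE[OF pb] p q HomD(2,3) by metis
  have sq': "f \<cdot> (p \<cdot> u) = g \<cdot> (q \<cdot> u)" if "u \<in> Hom C x d" for u x
    using sq Comp_assoc[OF that p f] Comp_assoc[OF that q g] by simp
  have zero: "zero_arr C (f \<cdot> (p \<cdot> u))" if "u \<in> Hom C x d" "zero_arr C (q \<cdot> u)" for u x
    using sq'[OF that(1)] zero_arr_comp_left[OF that(2) Comp_in_Hom[OF that(1) q] g] by simp
  have qk_comp: "zero_arr C (q \<cdot> (k \<cdot> h))" if "h \<in> Hom C x e" for h x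
    using zero_arr_comp_right[OF qk that Comp_in_Hom[OF k q]] Comp_assoc[OF that k q] by simp
  have pk: "p \<cdot> k \<in> Hom C e a" using Comp_in_Hom[OF k p] .
  \<comment> \<open>Factoring \<open>p \<cdot> u\<close> through \<open>p \<cdot> k\<close> amounts
    to factoring \<open>u\<close> through \<open>k\<close>: after composing with \<open>q\<close>
    both sides are zero, so joint monicity applies.\<close>
  have lift: "(p \<cdot> k) \<cdot> h = p \<cdot> u \<longleftrightarrow> k \<cdot> h = u"
    if "u \<in> Hom C x d" "zero_arr C (q \<cdot> u)" "h \<in> Hom C x e" for u h x
  proof
    assume "(p \<cdot> k) \<cdot> h = p \<cdot> u"
    then have "p \<cdot> (k \<cdot> h) = p \<cdot> u" using Comp_assoc[OF that(3) k p] by simp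
    moreover have "q \<cdot> (k \<cdot> h) = q \<cdot> u"
      using zero_arr_eq[OF qk_comp[OF that(3)] that(2)] that k q Comp_in_Hom by blast
    ultimately show "k \<cdot> h = u"
      using pullback_jointly_monic[OF pb p q Comp_in_Hom[OF that(3) k] that(1)] by simp
  qed (use Comp_assoc[OF that(3) k p] in simp)
  show ?thesis
  proof
    assume ker: "kernel C (p \<cdot> k) f"
    show "kernel C k q"
    proof (rule kernelI[OF k q qk])
      fix x u assume u: "u \<in> Hom C x d" "zero_arr C (q \<cdot> u)"
      show "\<exists>!h. h \<in> Hom C x e \<and> k \<cdot> h = u"
        using kernel_ex1[OF ker pk Comp_in_Hom[OF u(1) p] zero[OF u]] lift[OF u] by blast
    qed
  next
    assume ker: "kernel C k q"
    show "kernel C (p \<cdot> k) f"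
    proof (rule kernelI[OF pk f zero[OF k qk]])
      fix x u assume u: "u \<in> Hom C x a" "zero_arr C (f \<cdot> u)"
      obtain z y where z: "zero_object C z" and y: "y \<in> Hom C x z"
        using u(2) Comp_in_Hom[OF u(1) f] by (auto simp: zero_arr_def HomD)
      \<comment> \<open>Through \<open>z\<close> there is a zero arrow from \<open>x\<close> to
        \<open>b\<close>. Paired with \<open>u\<close> it forms a cone over \<open>(f, g)\<close>,
        since both composites into \<open>c\<close> are zero.\<close>
      obtain w' where w': "w' \<in> Hom C z b"
        using z Hom_objs[OF q] by (auto simp: zero_object_def)
      have zero_wy: "zero_arr C (w' \<cdot> y)"
        using zero_arr_iff[OF z y w' Comp_in_Hom[OF y w']] by simp
      have wy: "w' \<cdot> y \<in> Hom C x b" using Comp_in_Hom[OF y w'] .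
      have "f \<cdot> u = g \<cdot> (w' \<cdot> y)"
        using zero_arr_eq[OF u(2) zero_arr_comp_left[OF zero_wy wy g]
            Comp_in_Hom[OF u(1) f] Comp_in_Hom[OF wy g]] .
      then obtain v where v: "v \<in> Hom C x d" "p \<cdot> v = u" "q \<cdot> v = w' \<cdot> y"
        using pullback_lift[OF pb p q u(1) wy] by blast
      then have zv: "zero_arr C (q \<cdot> v)" using zero_wy by simp
      \<comment> \<open>As \<open>u = p \<cdot> v\<close>, the factorizations of \<open>u\<close>
        through \<open>p \<cdot> k\<close> are those of \<open>v\<close> through
        \<open>k\<close>.\<close>
      show "\<exists>!h. h \<in> Hom C x e \<and> (p \<cdot> k) \<cdot> h = u"
        using kernel_ex1[OF ker k v(1) zv] lift[OF v(1) zv, unfolded v(2)]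
        by (simp cong: conj_cong)
    qed
  qed
qed

end

section \<open>Recognizing pullbacks by the split short five lemma\<close>

context pointed_protomodular
begin

text \<open>Pulling \<open>f\<close> back along an arrow from a zero object gives the kernel as the
  leg opposite to that object.\<close>

lemma kernel_of_split_epi:
  assumes "split_epi C f"
  obtains k where "kernel C k f"
proof -
  obtain z where z: "zero_object C z" using pointed by blast
  have f: "f \<in> Hom C (Dom C f) (Cod C f)"
    using assms by (auto simp: split_epi_def section_of_def intro: HomI)
  obtain v where v: "v \<in> Hom C z (Cod C f)"
    using z Hom_objs[OF f] by (auto simp: zero_object_def)
  obtain k u where pb: "pullback C k u f v"
    using pullbacks_along_split_epis[OF assms] HomD[OF v] by blast
  then have "k \<in> Hom C (Dom C k) (Dom C f)" "u \<in> Hom C (Dom C k) z"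
    using v by (auto simp: pullback_def HomD intro: HomI)
  then show thesis using that kernel_iff_pullback[OF z _ f _ v] pb by blast
qed

text \<open>The square is compared with an actual pullback \<open>(p', q')\<close> of the same
  cospan. Both \<open>q\<close> and \<open>q'\<close> acquire kernels with the same domain and
  compatible sections, so the comparison arrow \<open>h\<close> is invertible by the split short
  five lemma.\<close>

lemma pullback_if_split_ses:
  assumes sq: "f \<cdot> p = g \<cdot> q" and p: "p \<in> Hom C d a" and q: "q \<in> Hom C d b"
    and f: "f \<in> Hom C a c" and g: "g \<in> Hom C b c"
    and kqt: "split_ses C k q t" and pkfs: "split_ses C (p \<cdot> k) f s" and pt: "p \<cdot> t = s \<cdot> g"
  shows "pullback C p q f g"
proof -
  have sec: "section_of C s f" and ker: "kernel C k q" and t: "t \<in> Hom C b d" "q \<cdot> t = Id C b"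
    using kqt pkfs q by (auto simp: split_ses_def section_of_def HomD)
  obtain e where k: "k \<in> Hom C e d"
    using kernelD[OF ker] q by (simp add: Hom_def)
  obtain p' q' where pb: "pullback C p' q' f g"
    using pullbacks_along_split_epis[of f g] sec f g by (auto simp: split_epi_def HomD)
  obtain d' where p': "p' \<in> Hom C d' a" and q': "q' \<in> Hom C d' b"
    using pullbackE[OF pb] f g HomD(2,3) by metis
  obtain t' where t': "t' \<in> Hom C b d'" "p' \<cdot> t' = s \<cdot> g" and sec': "section_of C t' q'"
    using pullback_section[OF pb q' p' sec] .
  have q't': "q' \<cdot> t' = Id C b" using sec' q' by (auto simp: section_of_def HomD)
  obtain h where h: "h \<in> Hom C d d'" and ph: "p' \<cdot> h = p" and qh: "q' \<cdot> h = q"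
    using pullback_lift[OF pb p' q' p q sq] .
  have hk: "h \<cdot> k \<in> Hom C e d'" using Comp_in_Hom[OF k h] .
  \<comment> \<open>Since \<open>p' \<cdot> (h \<cdot> k)\<close> equals \<open>p \<cdot> k\<close>,
    a kernel of \<open>f\<close>, the arrow \<open>h \<cdot> k\<close> is a kernel of
    \<open>q'\<close>. With this choice \<open>h\<close> induces the identity on kernels.\<close>
  have "q' \<cdot> (h \<cdot> k) = q \<cdot> k" "p' \<cdot> (h \<cdot> k) = p \<cdot> k"
    using comp_reassoc[OF qh h q' k] comp_reassoc[OF ph h p' k] by simp_all
  then have "kernel C (h \<cdot> k) q'"
    using kernel_pullback_iff[OF pb p' q' hk] kernelD[OF ker] pkfs by (simp add: split_ses_def)
  then have ses': "split_ses C (h \<cdot> k) q' t'" using sec' by (simp add: split_ses_def)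
  \<comment> \<open>Both arrows have components \<open>s \<cdot> g\<close> under \<open>p'\<close>
    and the identity under \<open>q'\<close>.\<close>
  have ht: "h \<cdot> t = t'"
    using comp_reassoc[OF qh h q' t(1)] comp_reassoc[OF ph h p' t(1)] t pt t'(2) q't'
    by (intro pullback_jointly_monic[OF pb p' q' Comp_in_Hom[OF t(1) h] t'(1)]) simp_all
  have objs: "e \<in> Obj C" "b \<in> Obj C" using Hom_objs[OF k] Hom_objs[OF q] by blast+
  have iso_Id: "iso_arr C (Id C x)" if "x \<in> Obj C" for x
    using Id_in_Hom[OF that] Comp_Id_left[OF Id_in_Hom[OF that]]
    by (auto simp: iso_arr_def HomD)
  have "split_ses_morphism C (k, q, t) (h \<cdot> k, q', t') (Id C e, h, Id C b)"
    using kqt ses' h ht qh Comp_Id_left[OF q] Comp_Id_right[OF hk] Comp_Id_right[OF t'(1)]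
    by (simp add: split_ses_morphism_def Id_in_Hom objs
        HomD(2)[OF k] HomD(2)[OF hk] HomD(2,3)[OF q] HomD(2,3)[OF q'])
  from split_short_five[OF this iso_Id[OF objs(1)] iso_Id[OF objs(2)]]
  show ?thesis using pullback_comp_iso[OF pb p' q' h] ph qh by simp
qed

end

section \<open>The two implications for a functor\<close>

context category_functor
begin

text \<open>\<open>F\<close> sends \<open>z\<close> to a zero object, so a kernel can be read as a
  pullback over \<open>z\<close> in \<open>A\<close> and read back over its image in
  \<open>B\<close>. Sections survive by functoriality.\<close>

lemma preserves_pullbacks_imp_protoadditive:
  assumes zA: "zero_object A z" and zp: "zero_preserving A B F"
    and pres: "preserves_pullbacks_along_split_epis A B F"
  shows "protoadditive A B F"
  unfolding protoadditive_def
proof (intro allI impI)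
  fix k f s assume ses: "split_ses A k f s"
  define a b c where "a = Dom A k" and "b = Dom A f" and "c = Cod A f"
  have k: "k \<in> Hom A a b" and f: "f \<in> Hom A b c" and s: "s \<in> Hom A c b"
    and ker: "kernel A k f" and fs: "f \<cdot>\<^bsub>A\<^esub> s = Id A c"
    using ses source.kernelD[of k f] unfolding a_def b_def c_def
    by (simp_all add: split_ses_def section_of_def Hom_def)
  have c: "c \<in> Obj A" using source.Hom_objs[OF f] by blast
  obtain u where u: "u \<in> Hom A a z"
    using zA source.Hom_objs[OF k] by (auto simp: zero_object_def)
  obtain v where v: "v \<in> Hom A z c"
    using zA c by (auto simp: zero_object_def)
  \<comment> \<open>The split epimorphism is the leg \<open>f\<close> of the cospan
    \<open>(f, v)\<close>, so the square presenting \<open>k\<close> as a kernel is among those that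
    \<open>F\<close> preserves.\<close>
  have "split_epi A f" using ses by (auto simp: split_ses_def split_epi_def)
  moreover have "pullback A k u f v"
    using source.kernel_iff_pullback[OF zA k f u v] ker by simp
  ultimately have "pullback B (on_arr F k) (on_arr F u) (on_arr F f) (on_arr F v)"
    using pres by (simp add: preserves_pullbacks_along_split_epis_def)
  moreover have "zero_object B (on_obj F z)" using zA zp by (simp add: zero_preserving_def)
  ultimately have "kernel B (on_arr F k) (on_arr F f)"
    using target.kernel_iff_pullback[OF _ on_arr_in_Hom[OF k] on_arr_in_Hom[OF f]
        on_arr_in_Hom[OF u] on_arr_in_Hom[OF v]] by simp
  moreover have "section_of B (on_arr F s) (on_arr F f)"
    using on_arr_in_Hom[OF f] on_arr_in_Hom[OF s] on_arr_Comp[OF s f] fs on_arr_Id[OF c]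
    by (simp add: section_of_def HomD)
  ultimately show "split_ses B (on_arr F k) (on_arr F f) (on_arr F s)"
    by (simp add: split_ses_def)
qed

text \<open>In \<open>A\<close> the square yields split short exact sequences ending in
  \<open>q\<close> and in \<open>f\<close>, with kernels \<open>k\<close> and
  \<open>p \<cdot> k\<close> and compatible sections. Their images are the data from which
  \<open>pullback_if_split_ses\<close> recognizes a pullback in \<open>B\<close>.\<close>

lemma protoadditive_imp_preserves_pullbacks:
  assumes "pointed_protomodular A" "pointed_protomodular B" and proto: "protoadditive A B F"
  shows "preserves_pullbacks_along_split_epis A B F"
  unfolding preserves_pullbacks_along_split_epis_def
proof (intro allI impI)
  interpret A: pointed_protomodular A by fact
  interpret B: pointed_protomodular B by fact
  fix p q f g assume "split_epi A f \<and> pullback A p q f g"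
  then obtain s where s: "section_of A s f" and pb: "pullback A p q f g"
    by (auto simp: split_epi_def)
  obtain a b c d where p: "p \<in> Hom A d a" and q: "q \<in> Hom A d b" and f: "f \<in> Hom A a c"
    and g: "g \<in> Hom A b c" and sq: "f \<cdot>\<^bsub>A\<^esub> p = g \<cdot>\<^bsub>A\<^esub> q"
    using source.pullbackE[OF pb] .
  obtain t where t: "t \<in> Hom A b d" "p \<cdot>\<^bsub>A\<^esub> t = s \<cdot>\<^bsub>A\<^esub> g" and sec: "section_of A t q"
    using source.pullback_section[OF pb q p s] .
  obtain k where ker: "kernel A k q"
    using A.kernel_of_split_epi sec by (auto simp: split_epi_def)
  then have k: "k \<in> Hom A (Dom A k) d"
    using q source.kernelD[OF ker] by (simp add: Hom_def)
  have "kernel A (p \<cdot>\<^bsub>A\<^esub> k) f"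
    using source.kernel_pullback_iff[OF pb p q k] ker source.kernelD(4)[OF ker] by simp
  then have "split_ses B (on_arr F (p \<cdot>\<^bsub>A\<^esub> k)) (on_arr F f) (on_arr F s)"
    using proto s by (simp add: protoadditive_def split_ses_def)
  \<comment> \<open>Functoriality splits the image of \<open>p \<cdot> k\<close>, so that both image
    sequences visibly have the kernel object of \<open>F q\<close> in common.\<close>
  then have ses: "split_ses B (on_arr F p \<cdot>\<^bsub>B\<^esub> on_arr F k) (on_arr F f) (on_arr F s)"
    using on_arr_Comp[OF k p] by simp
  have ses': "split_ses B (on_arr F k) (on_arr F q) (on_arr F t)"
    using proto sec ker by (simp add: protoadditive_def split_ses_def)
  have "s \<in> Hom A c a" using s f by (auto simp: section_of_def HomD)
  then have Fpt: "on_arr F p \<cdot>\<^bsub>B\<^esub> on_arr F t = on_arr F s \<cdot>\<^bsub>B\<^esub> on_arr F g"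
    using on_arr_Comp[OF t(1) p] on_arr_Comp[OF g] t(2) by simp
  have Fsq: "on_arr F f \<cdot>\<^bsub>B\<^esub> on_arr F p = on_arr F g \<cdot>\<^bsub>B\<^esub> on_arr F q"
    using on_arr_Comp[OF p f] on_arr_Comp[OF q g] sq by simp
  show "pullback B (on_arr F p) (on_arr F q) (on_arr F f) (on_arr F g)"
    using B.pullback_if_split_ses[OF Fsq on_arr_in_Hom[OF p] on_arr_in_Hom[OF q]
        on_arr_in_Hom[OF f] on_arr_in_Hom[OF g] ses' ses Fpt] .
qed

end

theorem proposition2p2:
  fixes A :: "('o, 'm) precategory"
    and B :: "('p, 'n) precategory"
    and F :: "('o, 'm, 'p, 'n) prefunctor"
  assumes "pointed_protomodular A"
    and "pointed_protomodular B"
    and "category_functor A B F"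
    and "zero_preserving A B F"
  shows "protoadditive A B F \<longleftrightarrow> preserves_pullbacks_along_split_epis A B F"
  using category_functor.protoadditive_imp_preserves_pullbacks[OF assms(3,1,2)]
    category_functor.preserves_pullbacks_imp_protoadditive[OF assms(3) _ assms(4)]
    pointed_protomodular.pointed[OF assms(1)]
  by blast

end
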